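(* Let $n\ge 1$ and let $X$ be an invertible $n\times n$ complex matrix. If $$\sum_{i=1}^{n}|X_{ij}|^2=1\quad\text{and}\quad \sum_{i=1}^{n}|(X^{-1})_{ij}|^2=1\qquad\text{for all } j\in\{1,\dots,n\},$$ then $X$ is unitary.
   Context: $(X^{-1})_{ij}$ denotes the $(i,j)$ entry of the inverse matrix $X^{-1}$. In the paper $X$ is the change-of-basis matrix between an orthonormal basis $(v_i)$ and a (possibly non-orthogonal) basis $(v'_j)$ of an $n$-dimensional complex Hilbert space, $v'_j=\sum_i X_{ij}v_i$. *)

theory Defs
  imports "HOL-Analysis.Analysis"
begin

definition conj_transpose :: "complex^'n^'m \<Rightarrow> complex^'m^'n"
  where "conj_transpose A = (\<chi> i j. cnj (A $ j $ i))"

(* orthogonal_matrix also applies to complex matrices, but uses the transpose without conjugation. *)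
definition unitary_matrix :: "complex^'n^'n \<Rightarrow> bool"
  where "unitary_matrix U \<longleftrightarrow>
    conj_transpose U ** U = mat 1 \<and> U ** conj_transpose U = mat 1"

end

theory Submission
  imports Defs
begin

text \<open>Write \<open>Y\<close> for the inverse of \<open>X\<close>. Both hypotheses only enter through the Frobenius norms
  \<open>\<parallel>X\<parallel>\<^sup>2 = \<parallel>Y\<parallel>\<^sup>2 = n\<close>. Since the Frobenius inner product of \<open>X\<close> and \<open>Y\<^sup>*\<close> is
  \<open>tr (X Y) = n\<close>, we get \<open>\<parallel>X - Y\<^sup>*\<parallel>\<^sup>2 = n + n - 2 n = 0\<close>, so \<open>Y = X\<^sup>*\<close>.\<close>

text \<open>The cross term is \<open>Re (a * cnj (cnj b))\<close>: conjugating \<open>b\<close>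
  turns it into a term of an entry of \<open>X ** Y\<close>.\<close>

lemma cmod_diff_cnj_squared:
  "(cmod (a - cnj b))\<^sup>2 = (cmod a)\<^sup>2 + (cmod b)\<^sup>2 - 2 * Re (a * b)"
  unfolding cmod_power2 by (simp add: power2_eq_square algebra_simps)

theorem proposition3p2:
  fixes X :: "complex^'n^'n"
  assumes "invertible X"
    and "\<And>j. (\<Sum>i\<in>UNIV. (cmod (X $ i $ j))\<^sup>2) = 1"
    and "\<And>j. (\<Sum>i\<in>UNIV. (cmod (matrix_inv X $ i $ j))\<^sup>2) = 1"
  shows "unitary_matrix X"
proof -
  define Y where "Y = matrix_inv X"
  have XY: "X ** Y = mat 1" and YX: "Y ** X = mat 1"
    using someI_ex[OF assms(1)[unfolded invertible_def]]
    unfolding Y_def matrix_inv_def by auto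
  have "(\<Sum>k\<in>UNIV. X $ i $ k * Y $ k $ i) = 1" for i
    using arg_cong[OF XY, of "\<lambda>M. M $ i $ i"] by (simp add: matrix_matrix_mult_def mat_def)
  then have trace: "(\<Sum>k\<in>UNIV. Re (X $ i $ k * Y $ k $ i)) = 1" for i
    by (metis Re_sum one_complex.simps(1))
  \<comment> \<open>The hypotheses sum down columns, so the sums are swapped here; in
    \<open>normY\<close> the transposed indices make this unnecessary.\<close>
  have normX: "(\<Sum>i\<in>UNIV. \<Sum>k\<in>UNIV. (cmod (X $ i $ k))\<^sup>2) = CARD('n)"
    using assms(2) by (subst sum.swap) simp
  have normY: "(\<Sum>i\<in>UNIV. \<Sum>k\<in>UNIV. (cmod (Y $ k $ i))\<^sup>2) = CARD('n)"
    using assms(3) by (simp add: Y_def)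
  have "(\<Sum>i\<in>UNIV. \<Sum>k\<in>UNIV. (cmod (X $ i $ k - cnj (Y $ k $ i)))\<^sup>2) = 0"
    unfolding cmod_diff_cnj_squared
    \<comment> \<open>\<open>Re\<close> of the product must stay unexpanded, and the factor 2
      outside the inner sum, for \<open>trace\<close> to match.\<close>
    by (simp add: sum.distrib sum_subtractf normX normY trace del: times_complex.sel
        flip: sum_distrib_left)
  then have "X $ i $ k = cnj (Y $ k $ i)" for i k
    by (simp add: sum_nonneg_eq_0_iff sum_nonneg)
  then have "Y = conj_transpose X"
    by (simp add: conj_transpose_def vec_eq_iff)
  with XY YX show ?thesis
    by (simp add: unitary_matrix_def)
qed

end
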